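(* Let $f \in \mathbb{R}[X,Y]$ with $f \ge 0$ on $[0,1]\times\mathbb{R}$, let $m = \deg_Y f$ and $d = \deg_X f$, and suppose that $f$ is fully $m$-ic on $[0,1]$, that $f$ has a finite number of zeros in $[0,1]\times\mathbb{R}$, all of them lying on $\{0,1\}\times\mathbb{R}$, and that $\frac{\partial f}{\partial X}$ does not vanish at any of them. Then there exists $N \in \mathbb{N}_0$ such that $b_j \ge 0$ on $C$ for every $0 \le j \le N+d$; and for any such $N$ there exist $\sigma_0, \sigma_1 \in \sum\mathbb{R}[X,Y]^2$ such that $f = \sigma_0 + \sigma_1X(1-X)$ and $$\deg(\sigma_0) \le N+d+m+1, \qquad \deg(\sigma_1X(1-X)) \le N+d+m+1.$$
   Context: $\sum \mathbb{R}[X,Y]^2$ denotes the set of finite sums of squares of polynomials in $\mathbb{R}[X,Y]$; $\deg$ denotes total degree, and $\deg_X$, $\deg_Y$ denote the degrees in $X$ and $Y$. For $f \in \mathbb{R}[X,Y]$ with $m = \deg_Y f$, $f$ is fully $m$-ic on $[0,1]$ if for every $x \in [0,1]$ the polynomial $f(x,Y) \in \mathbb{R}[Y]$ has degree $m$. With $m = \deg_Y f$ and $d = \deg_X f$, write $f = \sum_{0 \le i \le m}\sum_{0 \le j \le d} a_{ji}X^jY^i$ and define $$F = \sum_{0 \le i \le m}\sum_{0 \le j \le d} a_{ji}X^j(W+X)^{d-j}Y^iZ^{m-i} \in \mathbb{R}[W,X,Y,Z].$$ For $N \in \mathbb{N}_0$ the polynomials $b_j \in \mathbb{R}[Y,Z]$,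 $0 \le j \le N+d$ (depending on $N$ and $f$) are defined by $$(W+X)^N F = \sum_{0 \le j \le N+d} b_j(Y,Z)\,W^jX^{N+d-j}.$$ $C = \{(y,z) \in \mathbb{R}^2 \mid y^2+z^2 = 1\}$. *)

theory Defs
  imports Complex_Main "HOL-Computational_Algebra.Polynomial"
begin

text \<open>
  Bivariate polynomials are iterated univariate ones: an element of \<open>R[U,V]\<close> is
  represented as a member of \<open>R[U][V]\<close>, so the first variable is the inner one and
  \<open>coeff (coeff p i) j\<close> is the coefficient of \<open>U\<^sup>j V\<^sup>i\<close>.
  This is used for \<open>R[X,Y]\<close>, for \<open>R[Y,Z]\<close>, and for \<open>R[W,X,Y,Z] = R[Y,Z][W,X]\<close>,
  which thus is the type \<open>real poly poly poly poly\<close>, with the variables ordered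
  \<open>Y, Z, W, X\<close> from the innermost to the outermost.
\<close>

abbreviation var1 :: "'a::comm_semiring_1 poly poly" where
  "var1 \<equiv> [:[:0, 1:]:]"

abbreviation var2 :: "'a::comm_semiring_1 poly poly" where
  "var2 \<equiv> [:0, 1:]"

abbreviation const2 :: "'a::comm_semiring_1 \<Rightarrow> 'a poly poly" where
  "const2 c \<equiv> [:[:c:]:]"

text \<open>The polynomial \<open>p(x, V)\<close> in \<open>R[V]\<close>, and the value \<open>p(x, y)\<close>.\<close>

definition subst1 :: "'a::comm_semiring_1 poly poly \<Rightarrow> 'a \<Rightarrow> 'a poly" where
  "subst1 p x = map_poly (\<lambda>c. poly c x) p"

definition eval2 :: "'a::comm_semiring_1 poly poly \<Rightarrow> 'a \<Rightarrow> 'a \<Rightarrow> 'a" where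
  "eval2 p x y = poly (subst1 p x) y"

definition pderiv1 :: "real poly poly \<Rightarrow> real poly poly" where
  "pderiv1 p = map_poly pderiv p"

text \<open>The degrees of the zero polynomial are 0, as for the library's \<open>degree\<close>.\<close>

definition deg1 :: "'a::zero poly poly \<Rightarrow> nat" where
  "deg1 p = (MAX i\<in>{..degree p}. degree (coeff p i))"

abbreviation deg2 :: "'a::zero poly poly \<Rightarrow> nat" where
  "deg2 p \<equiv> degree p"

definition total_deg :: "'a::zero poly poly \<Rightarrow> nat" where
  "total_deg p = Max (insert 0 {j + i | j i. coeff (coeff p i) j \<noteq> 0})"

definition sums_of_squares :: "'a::comm_semiring_1 set" where
  "sums_of_squares = {s. \<exists>qs. s = (\<Sum>q\<leftarrow>qs. q ^ 2)}"

text \<open>The condition \<open>\<noteq> 0\<close> excludes the zero polynomial when \<open>m = 0\<close>, as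
  \<open>degree 0 = 0\<close> in the library.\<close>

definition fully_ic :: "nat \<Rightarrow> real poly poly \<Rightarrow> bool" where
  "fully_ic m f \<longleftrightarrow> (\<forall>x\<in>{0..1}. subst1 f x \<noteq> 0 \<and> degree (subst1 f x) = m)"

definition strip_zeros :: "real poly poly \<Rightarrow> (real \<times> real) set" where
  "strip_zeros f = {(x, y). x \<in> {0..1} \<and> eval2 f x y = 0}"

definition homF :: "real poly poly \<Rightarrow> real poly poly poly poly" where
  "homF f =
     (let m = deg2 f; d = deg1 f; W = var1; X = var2; Y = const2 var1; Z = const2 var2
      in \<Sum>i\<le>m. \<Sum>j\<le>d. const2 (const2 (coeff (coeff f i) j))
           * X ^ j * (W + X) ^ (d - j) * Y ^ i * Z ^ (m - i))"

text \<open>The coefficient of \<open>W\<^sup>j X\<^bsup>N+d-j\<^esup>\<close> in \<open>(W + X)\<^sup>N F\<close>;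
  see \<open>homF_expansion\<close> below.\<close>

definition bpoly :: "real poly poly \<Rightarrow> nat \<Rightarrow> nat \<Rightarrow> real poly poly" where
  "bpoly f N j = coeff (coeff ((var1 + var2) ^ N * homF f) (N + deg1 f - j)) j"

definition circle :: "(real \<times> real) set" where
  "circle = {(y, z). y\<^sup>2 + z\<^sup>2 = 1}"


lemma eval2_altdef: "eval2 p x y = (\<Sum>i\<le>degree p. poly (coeff p i) x * y ^ i)"
proof -
  have "degree (subst1 p x) \<le> degree p"
    by (simp add: subst1_def map_poly_degree_leq)
  then have "eval2 p x y = (\<Sum>i\<le>degree p. coeff (subst1 p x) i * y ^ i)"
    unfolding eval2_def poly_altdef
    by (intro sum.mono_neutral_left) (auto simp: coeff_eq_0)
  then show ?thesis
    by (simp add: subst1_def coeff_map_poly)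
qed

lemma finite_exponents: "finite {j + i | j i. coeff (coeff p i) j \<noteq> 0}"
proof (rule finite_subset)
  show "{j + i | j i. coeff (coeff p i) j \<noteq> 0}
      \<subseteq> (\<lambda>(j, i). j + i) ` (SIGMA j:{..deg1 p}. {..degree p})"
  proof clarify
    fix j i assume nz: "coeff (coeff p i) j \<noteq> 0"
    then have i: "i \<le> degree p"
      by (metis coeff_0 le_degree)
    have "j \<le> degree (coeff p i)"
      using nz by (rule le_degree)
    also have "\<dots> \<le> deg1 p"
      using i by (auto simp: deg1_def)
    finally show "j + i \<in> (\<lambda>(j, i). j + i) ` (SIGMA j:{..deg1 p}. {..degree p})"
      using i by force
  qed
qed simp

lemma total_deg_le_iff:
  "total_deg p \<le> n \<longleftrightarrow> (\<forall>i j. coeff (coeff p i) j \<noteq> 0 \<longrightarrow> j + i \<le> n)"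
  using finite_exponents[of p] by (auto simp: total_deg_def)

definition homogeneous2 :: "nat \<Rightarrow> 'a::comm_semiring_1 poly poly \<Rightarrow> bool" where
  "homogeneous2 n p \<longleftrightarrow> (\<forall>i j. i + j \<noteq> n \<longrightarrow> coeff (coeff p i) j = 0)"

lemma homogeneous2_mult:
  assumes "homogeneous2 a p" "homogeneous2 b q"
  shows "homogeneous2 (a + b) (p * q)"
  unfolding homogeneous2_def
proof (intro allI impI)
  fix i j assume ne: "i + j \<noteq> a + b"
  have "coeff (coeff p k) l * coeff (coeff q (i - k)) (j - l) = 0"
    if "k \<le> i" "l \<le> j" for k l
  proof (cases "k + l = a")
    case True
    then have "(i - k) + (j - l) \<noteq> b" using that ne by linarith
    then show ?thesis using assms(2) by (simp add: homogeneous2_def)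
  next
    case False
    then show ?thesis using assms(1) by (simp add: homogeneous2_def)
  qed
  then show "coeff (coeff (p * q) i) j = 0"
    by (simp add: coeff_mult coeff_sum)
qed

lemma homogeneous2_sum:
  "(\<And>x. x \<in> A \<Longrightarrow> homogeneous2 n (g x)) \<Longrightarrow> homogeneous2 n (sum g A)"
  by (simp add: homogeneous2_def coeff_sum)

lemma homogeneous2_const2: "homogeneous2 0 (const2 c)"
  by (auto simp: homogeneous2_def coeff_pCons split: nat.splits)

lemma homogeneous2_power:
  "homogeneous2 a p \<Longrightarrow> homogeneous2 (k * a) (p ^ k)"
proof (induction k)
  case 0
  show ?case using homogeneous2_const2[of 1] by (simp add: one_pCons)
next
  case (Suc k)
  then show ?case using homogeneous2_mult[of a p "k * a" "p ^ k"] by simp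
qed

lemma homogeneous2_linear:
  "homogeneous2 1 var1" "homogeneous2 1 var2" "homogeneous2 1 (var1 + var2)"
  by (auto simp: homogeneous2_def coeff_pCons split: nat.splits)

lemma coeff_monomial2:
  "coeff (coeff (const2 c * var1 ^ j * var2 ^ k) i) l = (if i = k \<and> l = j then c else 0)"
proof -
  have var1: "var1 ^ j = [:monom 1 j:]" and var2: "var2 ^ k = monom 1 k"
    for j k by (simp_all add: poly_const_pow monom_altdef)
  have "const2 c * var1 ^ j * var2 ^ k = monom (monom c j) k"
    by (simp add: var1 var2 smult_monom)
  then show ?thesis by auto
qed

lemma homogeneous2_expansion:
  assumes "homogeneous2 n p"
  shows "p = (\<Sum>j\<le>n. const2 (coeff (coeff p (n - j)) j) * var1 ^ j * var2 ^ (n - j))"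
    (is "p = ?S")
proof (intro poly_eqI)
  fix i l
  have "coeff (coeff ?S i) l
      = (\<Sum>j\<le>n. if i = n - j \<and> l = j then coeff (coeff p (n - j)) j else 0)"
    by (simp only: coeff_sum coeff_monomial2)
  also have "\<dots> = (\<Sum>j\<le>n. if j = l then (if i + l = n then coeff (coeff p i) l else 0) else 0)"
    by (intro sum.cong) auto
  also have "\<dots> = coeff (coeff p i) l"
    using assms by (auto simp: homogeneous2_def)
  finally show "coeff (coeff p i) l = coeff (coeff ?S i) l" by simp
qed

lemma homogeneous2_homF: "homogeneous2 (deg1 f) (homF f)"
  unfolding homF_def Let_def
proof (intro homogeneous2_sum)
  fix i j assume "j \<in> {..deg1 f}"
  have "homogeneous2 (0 + j * 1 + (deg1 f - j) * 1 + i * 0 + (deg2 f - i) * 0)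
     (const2 (const2 (coeff (coeff f i) j)) * var2 ^ j * (var1 + var2) ^ (deg1 f - j)
       * const2 var1 ^ i * const2 var2 ^ (deg2 f - i))"
    by (intro homogeneous2_mult homogeneous2_power homogeneous2_const2 homogeneous2_linear)
  then show "homogeneous2 (deg1 f)
     (const2 (const2 (coeff (coeff f i) j)) * var2 ^ j * (var1 + var2) ^ (deg1 f - j)
       * const2 var1 ^ i * const2 var2 ^ (deg2 f - i))"
    using \<open>j \<in> {..deg1 f}\<close> by simp
qed

lemma homF_expansion:
  "(var1 + var2) ^ N * homF f
     = (\<Sum>j\<le>N + deg1 f. const2 (bpoly f N j) * var1 ^ j * var2 ^ (N + deg1 f - j))"
proof -
  have "homogeneous2 (N * 1 + deg1 f) ((var1 + var2) ^ N * homF f)"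
    by (intro homogeneous2_mult homogeneous2_power homogeneous2_linear homogeneous2_homF)
  then show ?thesis
    unfolding bpoly_def using homogeneous2_expansion by simp
qed

end

(*
  The coefficient b_j is a scaled Bernstein coefficient, of degree n = N + d, of the homogenised
  slice x |-> z^m f(x, y/z).  Its value at index k = n - j is, up to a binomial factor,
  the sum over l of g_l k(k-1)...(k-l+1) / (n(n-1)...(n-l+1)), where g_l are the coefficients of
  the slice.  If no N worked, the points (k/n, y, z) at which some b_j is negative would accumulate,
  by compactness, at a zero of the slice, hence at an end point of [0,1]; there the value is at least
  k/n times a quantity converging to the nonzero derivative, which rules out negative signs.
  For the certificate, substitute W = 1 - X and Z = 1, write each b_j(Y,1) as a sum of two
  squares, and absorb odd powers by X = X^2 + X(1-X) and 1 - X = (1-X)^2 + X(1-X).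
*)
theory Submission
  imports Defs "HOL-Analysis.Elementary_Metric_Spaces"
    "HOL-Computational_Algebra.Fundamental_Theorem_Algebra"
begin

section \<open>Nonnegative univariate polynomials\<close>

lemma nonneg_poly_lead_coeff:
  fixes p :: "real poly"
  assumes "\<And>x. poly p x \<ge> 0" "p \<noteq> 0"
  shows "lead_coeff p > 0"
proof (rule ccontr)
  assume "\<not> lead_coeff p > 0"
  then have "0 < lead_coeff (- p)"
    using assms(2) by (simp add: less_le)
  from poly_pinfty_gt_lc[OF this] obtain n where "\<And>x. x \<ge> n \<Longrightarrow> lead_coeff (-p) \<le> poly (-p) x"
    by blast
  with \<open>0 < lead_coeff (- p)\<close> have "poly p n < 0"
    by (metis neg_0_less_iff_less order.refl order.strict_trans2 poly_minus)
  then show False using assms(1)[of n] by simp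
qed

text \<open>Replacing x by -x multiplies the leading coefficient by (-1)^(degree), while both
  polynomials are nonnegative and so have positive leading coefficients.\<close>

lemma nonneg_poly_even_degree:
  fixes p :: "real poly"
  assumes "\<And>x. poly p x \<ge> 0"
  shows "even (degree p)"
proof (cases "p = 0")
  case False
  let ?q = "pcompose p [:0, -1:]"
  have "lead_coeff ?q = lead_coeff p * (-1) ^ degree p"
    by (subst lead_coeff_comp) auto
  moreover have "lead_coeff ?q > 0"
    using False assms by (intro nonneg_poly_lead_coeff) (auto simp: poly_pcompose pcompose_eq_0_iff)
  moreover have "lead_coeff p > 0"
    using assms False by (rule nonneg_poly_lead_coeff)
  ultimately show ?thesis
    by (cases "even (degree p)") auto
qed auto

lemma nonneg_poly_punctured:
  fixes p :: "real poly"
  assumes "\<And>x. x \<noteq> a \<Longrightarrow> poly p x \<ge> 0"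
  shows "poly p a \<ge> 0"
proof (rule tendsto_lowerbound)
  show "(poly p \<longlongrightarrow> poly p a) (at a)"
    using poly_isCont[of a p] by (simp add: isCont_def)
  show "\<forall>\<^sub>F x in at a. 0 \<le> poly p x"
    using assms by (auto simp: eventually_at_filter)
qed auto

text \<open>After one linear factor is removed, the quotient has the sign of x - a away from a, so
  its one-sided limits force it to vanish at a as well.\<close>

lemma nonneg_poly_double_root:
  fixes p :: "real poly"
  assumes nonneg: "\<And>x. poly p x \<ge> 0" and root: "poly p a = 0"
  obtains r where "p = [:-a, 1:]\<^sup>2 * r"
proof -
  obtain q where q: "p = [:-a, 1:] * q"
    using root by (metis dvdE poly_eq_0_iff_dvd)
  have sign: "(x - a) * poly q x \<ge> 0" for x
    using nonneg[of x] by (simp add: q algebra_simps)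
  have lim: "(poly q \<longlongrightarrow> poly q a) (at_right a)" "(poly q \<longlongrightarrow> poly q a) (at_left a)"
    using poly_isCont[of a q] by (simp_all add: isCont_def filterlim_at_split)
  have "poly q a \<ge> 0"
  proof (rule tendsto_lowerbound[OF lim(1)])
    show "\<forall>\<^sub>F x in at_right a. 0 \<le> poly q x"
      unfolding eventually_at_filter
    proof (intro always_eventually allI impI)
      fix x assume "x \<in> {a<..}"
      then show "0 \<le> poly q x" using sign[of x] by (simp add: zero_le_mult_iff)
    qed
  qed auto
  moreover have "poly q a \<le> 0"
  proof (rule tendsto_upperbound[OF lim(2)])
    show "\<forall>\<^sub>F x in at_left a. 0 \<ge> poly q x"
      unfolding eventually_at_filter
    proof (intro always_eventually allI impI)
      fix x assume "x \<in> {..<a}"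
      then show "0 \<ge> poly q x" using sign[of x] by (simp add: zero_le_mult_iff)
    qed
  qed auto
  ultimately have "poly q a = 0" by simp
  then obtain r where "q = [:-a, 1:] * r"
    by (metis dvdE poly_eq_0_iff_dvd)
  then show ?thesis
    using that[of r] by (simp only: q power2_eq_square mult.assoc)
qed

lemma poly_map_poly_of_real:
  fixes z :: "'a::real_field"
  shows "poly (map_poly of_real (p + q)) z = poly (map_poly of_real p) z + poly (map_poly of_real q) z"
    and "poly (map_poly of_real (p * q)) z = poly (map_poly of_real p) z * poly (map_poly of_real q) z"
    and "poly (map_poly of_real p) (of_real x :: 'a) = of_real (poly p x)"
proof -
  have add: "map_poly of_real (p + q) = map_poly of_real p + (map_poly of_real q :: 'a poly)" for p q
    by (rule poly_eqI) (simp add: coeff_map_poly)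
  have smult: "map_poly of_real (smult c p) = smult (of_real c) (map_poly of_real p :: 'a poly)" for c p
    by (rule poly_eqI) (simp add: coeff_map_poly)
  show "poly (map_poly of_real (p + q)) z = poly (map_poly of_real p) z + poly (map_poly of_real q) z"
    by (simp add: add)
  show "poly (map_poly of_real (p * q)) z = poly (map_poly of_real p) z * poly (map_poly of_real q) z"
    by (induction p) (simp_all add: map_poly_pCons add smult algebra_simps)
  show "poly (map_poly of_real p) (of_real x :: 'a) = of_real (poly p x)"
    by (induction p) (simp_all add: map_poly_pCons)
qed

text \<open>The quadratic is (T - z)(T - conj z). The remainder modulo it is a real u + v T
  vanishing at \<open>z\<close>; the imaginary part gives v = 0, and then u = 0.\<close>

lemma nonreal_root_quadratic_dvd:
  fixes p :: "real poly"
  assumes root: "poly (map_poly of_real p) z = (0::complex)" and im: "Im z \<noteq> 0"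
  shows "[:(Re z)\<^sup>2 + (Im z)\<^sup>2, -2 * Re z, 1:] dvd p"
proof -
  define s where "s = [:(Re z)\<^sup>2 + (Im z)\<^sup>2, -2 * Re z, 1:]"
  define r where "r = p mod s"
  have deg: "degree s = 2" by (simp add: s_def)
  have "degree r < 2"
    using degree_mod_less[of s p] deg by (auto simp: r_def s_def)
  then have "r = [:coeff r 0, coeff r 1:]"
    by (intro poly_eqI) (auto simp: coeff_pCons coeff_eq_0 split: nat.splits)
  then obtain u v where r: "r = [:u, v:]" by blast
  have ev: "poly (map_poly of_real (a * b + c)) z
      = poly (map_poly of_real a) z * poly (map_poly of_real b) z + poly (map_poly complex_of_real c) z"
    for a b c :: "real poly"
    by (simp only: poly_map_poly_of_real)
  have "poly (map_poly complex_of_real s) z = 0"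
    by (simp add: s_def map_poly_pCons complex_eq_iff power2_eq_square algebra_simps)
  then have "poly (map_poly complex_of_real r) z = 0"
    using root ev[of "p div s" s r] by (simp add: r_def)
  then have "complex_of_real u + z * complex_of_real v = 0"
    by (simp add: r map_poly_pCons)
  then have "u = 0 \<and> v = 0"
    using im by (auto simp: complex_eq_iff)
  then have "r = 0" by (simp add: r)
  then show ?thesis by (simp add: r_def s_def mod_eq_0_iff_dvd)
qed

text \<open>The Brahmagupta-Fibonacci identity.\<close>

lemma two_squares_mult:
  fixes a b c d :: "'a::comm_ring_1"
  shows "(a\<^sup>2 + b\<^sup>2) * (c\<^sup>2 + d\<^sup>2) = (a * c + b * d)\<^sup>2 + (a * d - b * c)\<^sup>2"
  by (simp add: power2_eq_square algebra_simps)

text \<open>Induction on the degree: a complex root a + bi splits off (x - a)^2 + b^2, the quotient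
  stays nonnegative, and the two-squares identity merges the factors. The degree bounds later
  control the total degree of the certificate.\<close>

lemma nonneg_poly_two_squares:
  fixes p :: "real poly"
  assumes "\<And>x. poly p x \<ge> 0"
  shows "\<exists>q1 q2. p = q1\<^sup>2 + q2\<^sup>2 \<and> 2 * degree q1 \<le> degree p \<and> 2 * degree q2 \<le> degree p"
  using assms
proof (induction "degree p" arbitrary: p rule: less_induct)
  case less
  show ?case
  proof (cases "degree p = 0")
    case True
    then obtain c where "p = [:c:]" by (rule degree_eq_zeroE)
    moreover from this have "c \<ge> 0" using less.prems[of 0] by simp
    ultimately have "p = [:sqrt c:]\<^sup>2 + 0\<^sup>2" by (simp add: power2_eq_square)
    with True show ?thesis by (metis degree_0 degree_pCons_0 le0 mult_0_right)
  next
    case False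
    have "degree (map_poly complex_of_real p) = degree p"
      by (simp add: degree_map_poly)
    with False have "\<not> constant (poly (map_poly complex_of_real p))"
      by (simp add: constant_degree)
    then obtain z where z: "poly (map_poly complex_of_real p) z = 0"
      using fundamental_theorem_of_algebra by blast
    define a b where "a = Re z" and "b = Im z"
    \<comment> \<open>A real root of a nonnegative polynomial is at least double, so b = 0 leads to
      the same quadratic as a conjugate pair.\<close>
    have "[:a\<^sup>2 + b\<^sup>2, -2 * a, 1:] dvd p"
    proof (cases "b = 0")
      case True
      then have "z = of_real a" by (simp add: a_def b_def complex_eq_iff)
      with z have "poly p a = 0"
        by (simp add: poly_map_poly_of_real)
      with less.prems obtain r where "p = [:-a, 1:]\<^sup>2 * r"
        using nonneg_poly_double_root by blast
      moreover have "[:a\<^sup>2 + b\<^sup>2, -2 * a, 1:] = [:-a, 1:]\<^sup>2"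
        using True by (simp add: power2_eq_square)
      ultimately show ?thesis by (simp only: dvd_triv_left)
    next
      case False
      then show ?thesis
        using nonreal_root_quadratic_dvd[OF z] by (simp add: a_def b_def)
    qed
    then obtain r where r: "p = [:a\<^sup>2 + b\<^sup>2, -2 * a, 1:] * r" by (rule dvdE)
    have p0: "p \<noteq> 0" "r \<noteq> 0" using False r by auto
    have deg: "degree p = 2 + degree r"
      unfolding r using p0 by (subst degree_mult_eq) auto
    have quad: "poly [:a\<^sup>2 + b\<^sup>2, -2 * a, 1:] x = (x - a)\<^sup>2 + b\<^sup>2" for x
      by (simp add: power2_eq_square algebra_simps)
    \<comment> \<open>For b = 0 the quadratic vanishes at a; there the sign of \<open>r\<close>
      follows by continuity.\<close>
    have off: "poly r x \<ge> 0" if "x \<noteq> a" for x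
    proof -
      have "((x - a)\<^sup>2 + b\<^sup>2) * poly r x \<ge> 0"
        using less.prems[of x] unfolding r poly_mult quad .
      moreover have "(x - a)\<^sup>2 + b\<^sup>2 > 0"
        using that by (simp add: add_pos_nonneg)
      ultimately show ?thesis by (simp add: zero_le_mult_iff)
    qed
    then have "poly r x \<ge> 0" for x
      using nonneg_poly_punctured[of a r] by (cases "x = a") auto
    with less.hyps[of r] deg obtain q1 q2 where q: "r = q1\<^sup>2 + q2\<^sup>2"
      "2 * degree q1 \<le> degree r" "2 * degree q2 \<le> degree r"
      by auto
    let ?l = "[:-a, 1:]"
    have "[:a\<^sup>2 + b\<^sup>2, -2 * a, 1:] = ?l\<^sup>2 + [:b:]\<^sup>2"
      by (simp add: power2_eq_square)
    then have "p = (?l * q1 + [:b:] * q2)\<^sup>2 + (?l * q2 - [:b:] * q1)\<^sup>2"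
      unfolding r q(1) by (simp only: two_squares_mult)
    moreover have "degree (?l * q) \<le> 1 + degree q" "degree ([:b:] * q) \<le> degree q" for q
      using degree_mult_le[of ?l q] degree_mult_le[of "[:b:]" q] by auto
    then have "degree (?l * q1 + [:b:] * q2) \<le> 1 + max (degree q1) (degree q2)"
        "degree (?l * q2 - [:b:] * q1) \<le> 1 + max (degree q1) (degree q2)"
      by (meson degree_add_le degree_diff_le le_max_iff_disj add_left_mono order_trans
          max.cobounded1 max.cobounded2 trans_le_add2)+
    ultimately show ?thesis
      using q(2,3) deg by (intro exI conjI) (assumption, auto)
  qed
qed

section \<open>Evaluation and total degree of bivariate polynomials\<close>

text \<open>Substituting a constant polynomial for the outer variable first makes evaluation a
  composite of ring homomorphisms, from which the simplification rules follow.\<close>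

lemma eval2_eq_poly: "eval2 p x y = poly (poly p [:y:]) x"
  by (simp add: eval2_altdef poly_altdef[of p] poly_sum poly_power)

lemma eval2_simps [simp]:
  "eval2 0 x y = 0" "eval2 1 x y = 1"
  "eval2 (p + q) x y = eval2 p x y + eval2 q x y"
  "eval2 (p - q) x y = eval2 p x y - eval2 q x y"
  "eval2 (p * q) x y = eval2 p x y * eval2 q x y"
  "eval2 (p ^ n) x y = eval2 p x y ^ n"
  "eval2 var1 x y = x"
  for x y :: "'a::comm_ring_1"
  by (simp_all add: eval2_eq_poly)

lemma eval2_sum [simp]: "eval2 (sum g A) x y = (\<Sum>i\<in>A. eval2 (g i) x y)"
  for x y :: "'a::comm_ring_1"
  by (simp add: eval2_eq_poly poly_sum)

text \<open>Real polynomials are determined by their values; this is used first for the outer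
  variable, then for each coefficient.\<close>

lemma eval2_eqI:
  fixes p q :: "real poly poly"
  assumes "\<And>x y. eval2 p x y = eval2 q x y"
  shows "p = q"
proof -
  have "subst1 p x = subst1 q x" for x
    using assms by (simp add: eval2_def poly_eq_poly_eq_iff[symmetric] fun_eq_iff)
  then have "poly (coeff p i) x = poly (coeff q i) x" for i x
    by (metis coeff_map_poly poly_0 subst1_def)
  then have "coeff p i = coeff q i" for i
    by (simp add: poly_eq_poly_eq_iff[symmetric] fun_eq_iff)
  then show ?thesis by (rule poly_eqI)
qed

definition lift2 :: "'a::comm_ring_1 poly \<Rightarrow> 'a poly poly" where
  "lift2 u = map_poly (\<lambda>c. [:c:]) u"

lemma eval2_lift2 [simp]: "eval2 (lift2 u) x y = poly u y"
proof -
  have "subst1 (lift2 u) x = u"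
    by (rule poly_eqI) (simp add: subst1_def lift2_def coeff_map_poly)
  then show ?thesis by (simp add: eval2_def)
qed

lemma total_deg_zero [simp]: "total_deg 0 = 0"
  using total_deg_le_iff[of 0 0] by simp

lemma total_deg_one [simp]: "total_deg (1 :: 'a::comm_semiring_1 poly poly) = 0"
  using total_deg_le_iff[of "1 :: 'a poly poly" 0]
  by (auto simp: one_pCons coeff_pCons split: nat.splits)

lemma total_deg_var1: "total_deg (var1 :: 'a::comm_semiring_1 poly poly) \<le> 1"
  and total_deg_one_minus_var1: "total_deg (1 - var1 :: real poly poly) \<le> 1"
  by (auto simp: total_deg_le_iff one_pCons coeff_pCons split: nat.splits)

lemma total_deg_lift2: "degree u \<le> D \<Longrightarrow> total_deg (lift2 u) \<le> D"
  unfolding total_deg_le_iff lift2_def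
  by (auto simp: coeff_map_poly coeff_pCons split: nat.splits dest: le_degree intro: order_trans)

lemma total_deg_add:
  "total_deg p \<le> D \<Longrightarrow> total_deg q \<le> D \<Longrightarrow> total_deg (p + q) \<le> D"
  unfolding total_deg_le_iff by (metis add.right_neutral coeff_add)

lemma total_deg_mult:
  assumes "total_deg p \<le> D" "total_deg q \<le> E"
  shows "total_deg (p * q) \<le> D + E"
  unfolding total_deg_le_iff
proof (intro allI impI)
  fix i j assume "coeff (coeff (p * q) i) j \<noteq> 0"
  then obtain k where k: "k \<le> i" "coeff (coeff p k * coeff q (i - k)) j \<noteq> 0"
    by (auto simp: coeff_mult[of p] coeff_sum elim!: sum.not_neutral_contains_not_neutral)
  from k(2) obtain l where l: "l \<le> j" "coeff (coeff p k) l * coeff (coeff q (i - k)) (j - l) \<noteq> 0"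
    by (auto simp: coeff_mult elim!: sum.not_neutral_contains_not_neutral)
  then have "coeff (coeff p k) l \<noteq> 0" "coeff (coeff q (i - k)) (j - l) \<noteq> 0"
    by auto
  then have "l + k \<le> D" "(j - l) + (i - k) \<le> E"
    using assms unfolding total_deg_le_iff by blast+
  then show "j + i \<le> D + E" using k(1) l(1) by linarith
qed

lemma total_deg_power: "total_deg p \<le> D \<Longrightarrow> total_deg (p ^ k) \<le> k * D"
  by (induction k) (auto intro: total_deg_mult)

section \<open>The truncated quadratic module\<close>

lemma sums_of_squares_add:
  assumes "p \<in> sums_of_squares" "q \<in> sums_of_squares"
  shows "p + q \<in> sums_of_squares"
proof -
  obtain ps qs where "p = (\<Sum>q\<leftarrow>ps. q ^ 2)" "q = (\<Sum>q\<leftarrow>qs. q ^ 2)"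
    using assms by (auto simp: sums_of_squares_def)
  then have "p + q = (\<Sum>q\<leftarrow>ps @ qs. q ^ 2)" by simp
  then show ?thesis unfolding sums_of_squares_def by blast
qed

lemma sums_of_squares_square: "q ^ 2 \<in> sums_of_squares"
  unfolding sums_of_squares_def by (auto intro!: exI[of _ "[q]"])

lemma sums_of_squares_zero: "0 \<in> sums_of_squares"
  unfolding sums_of_squares_def by (auto intro!: exI[of _ "[]"])

lemma sums_of_squares_square_mult:
  assumes "p \<in> sums_of_squares"
  shows "q ^ 2 * p \<in> sums_of_squares"
proof -
  obtain ps where "p = (\<Sum>q\<leftarrow>ps. q ^ 2)"
    using assms by (auto simp: sums_of_squares_def)
  then have "q ^ 2 * p = (\<Sum>r\<leftarrow>map ((*) q) ps. r ^ 2)"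
    by (simp add: o_def power_mult_distrib sum_list_const_mult)
  then show ?thesis unfolding sums_of_squares_def by blast
qed

text \<open>A degree truncation of the quadratic module generated by X(1-X). The summands are
  bounded separately because their top terms can cancel, as in X = X^2 + X(1-X).\<close>

definition qmodule :: "nat \<Rightarrow> real poly poly set" where
  "qmodule D = {p. \<exists>\<sigma>0\<in>sums_of_squares. \<exists>\<sigma>1\<in>sums_of_squares.
     p = \<sigma>0 + \<sigma>1 * var1 * (1 - var1) \<and>
     total_deg \<sigma>0 \<le> D \<and> total_deg (\<sigma>1 * var1 * (1 - var1)) \<le> D}"

lemma qmodule_mono: "p \<in> qmodule D \<Longrightarrow> D \<le> E \<Longrightarrow> p \<in> qmodule E"
  unfolding qmodule_def by (blast intro: order_trans)

lemma qmodule_zero: "0 \<in> qmodule D"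
  unfolding qmodule_def mem_Collect_eq
  by (rule bexI[OF bexI[OF _ sums_of_squares_zero] sums_of_squares_zero]) simp

lemma qmodule_add:
  assumes "p \<in> qmodule D" "q \<in> qmodule D"
  shows "p + q \<in> qmodule D"
proof -
  obtain s0 s1 t0 t1 where
    *: "s0 \<in> sums_of_squares" "s1 \<in> sums_of_squares" "t0 \<in> sums_of_squares" "t1 \<in> sums_of_squares"
    "p = s0 + s1 * var1 * (1 - var1)" "q = t0 + t1 * var1 * (1 - var1)"
    "total_deg s0 \<le> D" "total_deg (s1 * var1 * (1 - var1)) \<le> D"
    "total_deg t0 \<le> D" "total_deg (t1 * var1 * (1 - var1)) \<le> D"
    using assms unfolding qmodule_def by blast
  have split: "(s1 + t1) * var1 * (1 - var1) = s1 * var1 * (1 - var1) + t1 * var1 * (1 - var1)"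
    by (simp only: ring_distribs)
  have "p + q = (s0 + t0) + (s1 + t1) * var1 * (1 - var1)"
    unfolding split *(5,6) by (simp only: ac_simps)
  moreover have "total_deg ((s1 + t1) * var1 * (1 - var1)) \<le> D"
    unfolding split using * by (intro total_deg_add)
  ultimately show ?thesis
    unfolding qmodule_def using * by (blast intro: sums_of_squares_add total_deg_add)
qed

lemma qmodule_sum: "(\<And>i. i \<in> A \<Longrightarrow> g i \<in> qmodule D) \<Longrightarrow> sum g A \<in> qmodule D"
  by (induction A rule: infinite_finite_induct) (auto intro: qmodule_zero qmodule_add)

lemma qmodule_square_mult:
  assumes p: "p \<in> qmodule D" and q: "total_deg q \<le> E"
  shows "q\<^sup>2 * p \<in> qmodule (2 * E + D)"
proof -
  obtain s0 s1 where
    *: "s0 \<in> sums_of_squares" "s1 \<in> sums_of_squares" "p = s0 + s1 * var1 * (1 - var1)"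
    "total_deg s0 \<le> D" "total_deg (s1 * var1 * (1 - var1)) \<le> D"
    using p unfolding qmodule_def by blast
  have assoc: "(q\<^sup>2 * s1) * var1 * (1 - var1) = q\<^sup>2 * (s1 * var1 * (1 - var1))"
    by (simp only: ac_simps)
  have q2: "total_deg (q\<^sup>2) \<le> 2 * E"
    using q by (rule total_deg_power)
  have "q\<^sup>2 * p = q\<^sup>2 * s0 + (q\<^sup>2 * s1) * var1 * (1 - var1)"
    unfolding assoc *(3) by (simp only: ring_distribs)
  moreover have "total_deg ((q\<^sup>2 * s1) * var1 * (1 - var1)) \<le> 2 * E + D"
    unfolding assoc using * q2 by (intro total_deg_mult)
  moreover have "total_deg (q\<^sup>2 * s0) \<le> 2 * E + D"
    using * q2 by (intro total_deg_mult)
  ultimately show ?thesis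
    unfolding qmodule_def using * by (blast intro: sums_of_squares_square_mult)
qed

lemma one_in_sums_of_squares: "(1 :: 'a::comm_semiring_1) \<in> sums_of_squares"
  using sums_of_squares_square[of 1] by simp

lemma total_deg_var1_one_minus_var1: "total_deg (1 * var1 * (1 - var1) :: real poly poly) \<le> 2"
  using total_deg_mult[OF total_deg_var1 total_deg_one_minus_var1] by (simp add: numeral_2_eq_2)

text \<open>These are the factors that (1-X)^j X^k can leave behind once squares are removed,
  according to the parities of j and k.\<close>

lemma qmodule_generators:
  "1 \<in> qmodule 0" "var1 \<in> qmodule 2" "1 - var1 \<in> qmodule 2" "(1 - var1) * var1 \<in> qmodule 2"
proof -
  have *: "total_deg (1 * var1 * (1 - var1) :: real poly poly) \<le> 2"
    by (rule total_deg_var1_one_minus_var1)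
  have sq: "total_deg (var1\<^sup>2 :: real poly poly) \<le> 2" "total_deg ((1 - var1)\<^sup>2 :: real poly poly) \<le> 2"
    using total_deg_power[OF total_deg_var1, of 2] total_deg_power[OF total_deg_one_minus_var1, of 2]
    by simp_all
  show "1 \<in> qmodule 0"
    unfolding qmodule_def mem_Collect_eq
    by (rule bexI[OF bexI[OF _ sums_of_squares_zero] one_in_sums_of_squares]) simp
  have "(var1 :: real poly poly) = var1\<^sup>2 + 1 * var1 * (1 - var1)"
    by (rule eval2_eqI) (simp only: eval2_simps, simp add: power2_eq_square algebra_simps)
  then show "var1 \<in> qmodule 2"
    unfolding qmodule_def using * sq one_in_sums_of_squares sums_of_squares_square by blast
  have "(1 - var1 :: real poly poly) = (1 - var1)\<^sup>2 + 1 * var1 * (1 - var1)"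
    by (rule eval2_eqI) (simp only: eval2_simps, simp add: power2_eq_square algebra_simps)
  then show "1 - var1 \<in> qmodule 2"
    unfolding qmodule_def using * sq one_in_sums_of_squares sums_of_squares_square by blast
  have "((1 - var1) * var1 :: real poly poly) = 0 + 1 * var1 * (1 - var1)"
    by (rule eval2_eqI) (simp only: eval2_simps, simp)
  then show "(1 - var1) * var1 \<in> qmodule 2"
    unfolding qmodule_def mem_Collect_eq using *
    by (intro bexI[OF bexI[OF _ one_in_sums_of_squares] sums_of_squares_zero] conjI) simp_all
qed

lemma power_split_square:
  fixes a :: "'a::comm_monoid_mult"
  shows "a ^ n = (a ^ (n div 2))\<^sup>2 * (if odd n then a else 1)"
proof -
  have "a ^ n = a ^ (n div 2 * 2 + n mod 2)" by (simp only: div_mult_mod_eq)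
  then show ?thesis
    unfolding power_add power_mult by (auto simp: odd_iff_mod_2_eq_one)
qed

text \<open>The leftover factor costs degree 2 unless both exponents are even. If exactly one is
  odd, the total is j + k + 1; this is the source of the + 1 in the final bound.\<close>

lemma qmodule_bernstein_monomial:
  "(1 - var1) ^ j * var1 ^ k \<in> qmodule (j + k + 1)"
proof -
  define s :: "real poly poly" where "s = (1 - var1) ^ (j div 2) * var1 ^ (k div 2)"
  have s: "total_deg s \<le> j div 2 + k div 2"
    unfolding s_def
    using total_deg_mult[OF total_deg_power[OF total_deg_one_minus_var1] total_deg_power[OF total_deg_var1]]
    by (metis mult.right_neutral)
  define g :: "real poly poly" where
    "g = (if odd j then 1 - var1 else 1) * (if odd k then var1 else 1)"
  have "g \<in> qmodule (if odd j \<or> odd k then 2 else 0)"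
    by (cases "odd j"; cases "odd k";
        simp only: g_def if_True if_False simp_thms not_False_eq_True mult_1_left mult_1_right qmodule_generators)
  then have "s\<^sup>2 * g \<in> qmodule (2 * (j div 2 + k div 2) + (if odd j \<or> odd k then 2 else 0))"
    using s by (rule qmodule_square_mult)
  moreover have "2 * (j div 2 + k div 2) + (if odd j \<or> odd k then 2 else 0) \<le> j + k + 1"
    by presburger
  moreover have "(1 - var1) ^ j * var1 ^ k = s\<^sup>2 * g"
    unfolding s_def g_def power_mult_distrib
    using power_split_square[of "1 - var1 :: real poly poly" j] power_split_square[of "var1 :: real poly poly" k]
    by (simp only: mult_ac)
  ultimately show ?thesis
    by (metis qmodule_mono)
qed

text \<open>Each square in u = q1^2 + q2^2 has degree at most \<open>m\<close>, and multiplying by a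
  square stays in the module.\<close>

lemma qmodule_lift2_mult:
  assumes nonneg: "\<And>y. poly u y \<ge> 0" and deg: "degree u \<le> m" and p: "p \<in> qmodule D"
  shows "lift2 u * p \<in> qmodule (m + D)"
proof -
  obtain q1 q2 where q: "u = q1\<^sup>2 + q2\<^sup>2" "2 * degree q1 \<le> degree u" "2 * degree q2 \<le> degree u"
    using nonneg_poly_two_squares[OF nonneg] by blast
  have "(lift2 q)\<^sup>2 * p \<in> qmodule (m + D)" if "2 * degree q \<le> degree u" for q
    using qmodule_square_mult[OF p total_deg_lift2[of q, OF order.refl]] that deg
    by (elim qmodule_mono) linarith
  then have "(lift2 q1)\<^sup>2 * p + (lift2 q2)\<^sup>2 * p \<in> qmodule (m + D)"
    using q by (intro qmodule_add)
  moreover have "lift2 u * p = (lift2 q1)\<^sup>2 * p + (lift2 q2)\<^sup>2 * p"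
    by (rule eval2_eqI) (simp add: q(1) algebra_simps)
  ultimately show ?thesis by simp
qed

section \<open>Coefficients in the Bernstein basis\<close>

text \<open>The coefficient of w^j x^(n-j) in the degree n homogenisation, the sum of g_l x^l
  (w+x)^(n-l). It is a Bernstein coefficient times a binomial; \<open>d\<close> serves as a degree
  bound for \<open>g\<close>.\<close>

definition bern :: "nat \<Rightarrow> nat \<Rightarrow> real poly \<Rightarrow> nat \<Rightarrow> real" where
  "bern d n g j = (\<Sum>l\<le>d. coeff g l * real ((n - l) choose j))"

lemma bern_expansion:
  assumes "d \<le> n"
  shows "(\<Sum>j\<le>n. bern d n g j * w ^ j * x ^ (n - j)) = (\<Sum>l\<le>d. coeff g l * x ^ l * (w + x) ^ (n - l))"
proof -
  have inner: "(\<Sum>j\<le>n. real ((n - l) choose j) * w ^ j * x ^ (n - j)) = x ^ l * (w + x) ^ (n - l)"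
    if "l \<le> d" for l
  proof -
    have "(\<Sum>j\<le>n. real ((n - l) choose j) * w ^ j * x ^ (n - j))
        = (\<Sum>j\<le>n - l. real ((n - l) choose j) * w ^ j * x ^ (n - j))"
      by (rule sum.mono_neutral_right) (auto simp: binomial_eq_0)
    also have "\<dots> = (\<Sum>j\<le>n - l. x ^ l * (real ((n - l) choose j) * w ^ j * x ^ (n - l - j)))"
    proof (rule sum.cong)
      fix j assume "j \<in> {..n - l}"
      then have "n - j = l + (n - l - j)" using that assms by auto
      then have "x ^ (n - j) = x ^ l * x ^ (n - l - j)" by (metis power_add)
      then show "real ((n - l) choose j) * w ^ j * x ^ (n - j)
          = x ^ l * (real ((n - l) choose j) * w ^ j * x ^ (n - l - j))" by simp
    qed simp
    also have "\<dots> = x ^ l * (w + x) ^ (n - l)"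
      by (simp add: binomial_ring sum_distrib_left)
    finally show ?thesis .
  qed
  have "(\<Sum>j\<le>n. bern d n g j * w ^ j * x ^ (n - j))
      = (\<Sum>l\<le>d. \<Sum>j\<le>n. coeff g l * (real ((n - l) choose j) * w ^ j * x ^ (n - j)))"
    unfolding bern_def sum_distrib_right by (subst sum.swap) (simp only: mult.assoc)
  also have "\<dots> = (\<Sum>l\<le>d. coeff g l * x ^ l * (w + x) ^ (n - l))"
    by (intro sum.cong refl) (simp add: sum_distrib_left[symmetric] inner)
  finally show ?thesis .
qed

text \<open>The difference is a polynomial with infinitely many roots. Only w > 0 is tested, so that
  w + 1 may be divided by when the identity is derived.\<close>

lemma polyfun_coeffs_eq:
  fixes c c' :: "nat \<Rightarrow> real"
  assumes "\<And>w. w > 0 \<Longrightarrow> (\<Sum>j\<le>n. c j * w ^ j) = (\<Sum>j\<le>n. c' j * w ^ j)" and "j \<le> n"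
  shows "c j = c' j"
proof -
  define p where "p = (\<Sum>j\<le>n. monom (c j - c' j) j)"
  have "{0<..} \<subseteq> {w. poly p w = 0}"
    using assms(1) by (auto simp: p_def poly_sum poly_monom ring_distribs sum_subtractf)
  then have "infinite {w. poly p w = 0}"
    using infinite_Ioi finite_subset by blast
  then have "p = 0" using poly_roots_finite by blast
  then have "coeff p j = 0" by simp
  then show ?thesis using assms(2) by (simp add: p_def coeff_sum)
qed

lemma bern_expansion_rational:
  assumes "degree g \<le> d" "d \<le> n" "w + x \<noteq> 0"
  shows "(\<Sum>j\<le>n. bern d n g j * w ^ j * x ^ (n - j)) = (w + x) ^ n * poly g (x / (w + x))"
proof -
  have "poly g (x / (w + x)) = (\<Sum>l\<le>d. coeff g l * (x / (w + x)) ^ l)"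
    unfolding poly_altdef using assms(1)
    by (intro sum.mono_neutral_left) (auto simp: coeff_eq_0)
  moreover have "coeff g l * x ^ l * (w + x) ^ (n - l) = (w + x) ^ n * (coeff g l * (x / (w + x)) ^ l)"
    if "l \<le> d" for l
    using assms that by (simp add: power_diff power_divide)
  ultimately show ?thesis
    unfolding bern_expansion[OF assms(2)] by (simp only: sum_distrib_left) (rule sum.cong, simp_all)
qed

text \<open>The substitution x -> 1 - x interchanges w and x in the homogenised polynomial. Setting
  one of them to 1 reduces this to comparing coefficients in w.\<close>

lemma bern_reflect:
  assumes g: "degree g \<le> d" and d: "d \<le> n" and j: "j \<le> n"
  shows "bern d n (pcompose g [:1, -1:]) j = bern d n g (n - j)"
proof (rule polyfun_coeffs_eq[OF _ j])
  fix w :: real assume w: "w > 0"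
  let ?h = "pcompose g [:1, -1:]"
  have h: "degree ?h \<le> d" using g by (simp add: degree_pcompose)
  have "(\<Sum>j\<le>n. bern d n ?h j * w ^ j) = (w + 1) ^ n * poly ?h (1 / (w + 1))"
    using bern_expansion_rational[OF h d, of w 1] w by simp
  also have "poly ?h (1 / (w + 1)) = poly g (w / (1 + w))"
    using w by (simp add: poly_pcompose field_simps)
  also have "(w + 1) ^ n * poly g (w / (1 + w)) = (\<Sum>j\<le>n. bern d n g j * w ^ (n - j))"
    using bern_expansion_rational[OF g d, of 1 w] w by (simp add: add.commute)
  also have "\<dots> = (\<Sum>j\<le>n. bern d n g (n - j) * w ^ j)"
    using sum.nat_diff_reindex[of "\<lambda>i. bern d n g i * w ^ (n - i)" "Suc n"]
    by (simp add: lessThan_Suc_atMost)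
  finally show "(\<Sum>j\<le>n. bern d n ?h j * w ^ j) = (\<Sum>j\<le>n. bern d n g (n - j) * w ^ j)" .
qed

text \<open>The homogenisation of \<open>f\<close> in the second variable, as a polynomial in the first one.\<close>

definition slice :: "real poly poly \<Rightarrow> real \<Rightarrow> real \<Rightarrow> real poly" where
  "slice f y z = (\<Sum>i\<le>degree f. smult (y ^ i * z ^ (degree f - i)) (coeff f i))"

lemma degree_slice: "degree (slice f y z) \<le> deg1 f"
  unfolding slice_def
  by (intro degree_sum_le) (auto simp: deg1_def intro: order_trans[OF degree_smult_le])

lemma coeff_slice:
  "coeff (slice f y z) l = (\<Sum>i\<le>degree f. y ^ i * z ^ (degree f - i) * coeff (coeff f i) l)"
  by (simp add: slice_def coeff_sum)

lemma poly_slice: "poly (slice f y z) x = (\<Sum>i\<le>degree f. y ^ i * z ^ (degree f - i) * poly (coeff f i) x)"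
  by (simp add: slice_def poly_sum)

lemma poly_slice_scale: "poly (slice f (c * y) (c * z)) x = c ^ degree f * poly (slice f y z) x"
proof -
  have "(c * y) ^ i * (c * z) ^ (degree f - i) = c ^ degree f * (y ^ i * z ^ (degree f - i))"
    if "i \<le> degree f" for i
    using power_add[of c i "degree f - i"] that by (simp add: power_mult_distrib mult_ac)
  then show ?thesis
    by (simp add: poly_slice sum_distrib_left mult.assoc)
qed

lemma slice_scale: "slice f (c * y) (c * z) = smult (c ^ degree f) (slice f y z)"
  by (simp add: poly_eq_poly_eq_iff[symmetric] fun_eq_iff poly_slice_scale)

lemma poly_slice_1: "poly (slice f y 1) x = eval2 f x y"
  by (simp add: poly_slice eval2_altdef mult.commute)

lemma slice_nonzero: "z \<noteq> 0 \<Longrightarrow> slice f y z = smult (z ^ degree f) (slice f (y / z) 1)"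
  using slice_scale[of f z "y / z" 1] by simp

text \<open>At infinity only the top term survives, since \<open>0 ^ k\<close> is 0 for k > 0 and 1
  for k = 0.\<close>

lemma slice_0: "slice f y 0 = smult (y ^ degree f) (lead_coeff f)"
proof -
  have "slice f y 0 = (\<Sum>i\<in>{degree f}. smult (y ^ i * 0 ^ (degree f - i)) (coeff f i))"
    unfolding slice_def by (rule sum.mono_neutral_right) auto
  then show ?thesis by simp
qed

lemma bern_smult: "bern d n (smult c g) j = c * bern d n g j"
  by (simp add: bern_def sum_distrib_left mult.assoc)

text \<open>Two expansions of (W + X)^N F at X = 1 and W = w are compared: one from its homogeneity
  in W and X, one from the binomial theorem.\<close>

lemma eval2_bpoly:
  assumes "j \<le> N + deg1 f"
  shows "eval2 (bpoly f N j) y z = bern (deg1 f) (N + deg1 f) (slice f y z) j"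
proof (rule polyfun_coeffs_eq[OF _ assms])
  fix w :: real
  \<comment> \<open>The variables are substituted from the outermost inwards: X = 1, then W = w, Z =
    z, Y = y.\<close>
  define ev where "ev P = poly (poly (poly (poly P 1) [:[:w:]:]) [:z:]) y"
    for P :: "real poly poly poly poly"
  let ?d = "deg1 f" let ?m = "degree f"
  have "ev ((var1 + var2) ^ N * homF f)
      = (w + 1) ^ N * (\<Sum>i\<le>?m. \<Sum>j\<le>?d. coeff (coeff f i) j * (w + 1) ^ (?d - j) * y ^ i * z ^ (?m - i))"
    by (simp add: ev_def homF_def Let_def poly_sum mult.assoc)
  also have "\<dots> = (\<Sum>i\<le>?m. \<Sum>j\<le>?d. y ^ i * z ^ (?m - i) * coeff (coeff f i) j * (w + 1) ^ (N + ?d - j))"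
    unfolding sum_distrib_left
  proof (intro sum.cong refl)
    fix i j assume "j \<in> {..?d}"
    then have "N + ?d - j = N + (?d - j)" by auto
    then show "(w + 1) ^ N * (coeff (coeff f i) j * (w + 1) ^ (?d - j) * y ^ i * z ^ (?m - i))
        = y ^ i * z ^ (?m - i) * coeff (coeff f i) j * (w + 1) ^ (N + ?d - j)"
      by (simp add: power_add)
  qed
  also have "\<dots> = (\<Sum>l\<le>?d. coeff (slice f y z) l * (w + 1) ^ (N + ?d - l))"
    by (subst sum.swap) (simp add: coeff_slice sum_distrib_right)
  also have "\<dots> = (\<Sum>j\<le>N + ?d. bern ?d (N + ?d) (slice f y z) j * w ^ j)"
    using bern_expansion[of ?d "N + ?d" "slice f y z" w 1] by simp
  finally have "ev ((var1 + var2) ^ N * homF f) = \<dots>" .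
  moreover have "ev ((var1 + var2) ^ N * homF f) = (\<Sum>j\<le>N + ?d. eval2 (bpoly f N j) y z * w ^ j)"
    unfolding homF_expansion by (simp add: ev_def poly_sum eval2_eq_poly)
  ultimately show "(\<Sum>j\<le>N + ?d. eval2 (bpoly f N j) y z * w ^ j)
      = (\<Sum>j\<le>N + ?d. bern ?d (N + ?d) (slice f y z) j * w ^ j)" by simp
qed

text \<open>Homogeneity carries nonnegativity from the circle to the line z = 1. With w = 1 - x the
  expansion becomes one of \<open>f\<close> itself, each term of which lies in the truncated
  module.\<close>

lemma certificate:
  assumes circle: "\<And>j y z. j \<le> N + deg1 f \<Longrightarrow> (y, z) \<in> circle \<Longrightarrow> eval2 (bpoly f N j) y z \<ge> 0"
  shows "f \<in> qmodule (N + deg1 f + degree f + 1)"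
proof -
  define d n where "d = deg1 f" and "n = N + deg1 f"
  \<comment> \<open>This is b_j(Y, 1), assembled by linearity of \<open>bern\<close> from the
    coefficients of \<open>f\<close>, so that the degree bound is visible.\<close>
  define b where "b j = (\<Sum>i\<le>degree f. monom (bern d n (coeff f i) j) i)" for j
  have b: "poly (b j) y = bern d n (slice f y 1) j" for j y
  proof -
    have "bern d n (slice f y 1) j = (\<Sum>l\<le>d. \<Sum>i\<le>degree f. coeff (coeff f i) l * real ((n - l) choose j) * y ^ i)"
      unfolding bern_def coeff_slice sum_distrib_right by (simp add: mult_ac)
    also have "\<dots> = (\<Sum>i\<le>degree f. bern d n (coeff f i) j * y ^ i)"
      by (subst sum.swap) (simp add: bern_def sum_distrib_right)
    finally show ?thesis by (simp add: b_def poly_sum poly_monom)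
  qed
  have nonneg: "poly (b j) y \<ge> 0" if "j \<le> n" for j y
  proof -
    \<comment> \<open>Dividing (y, 1) by its norm moves it onto the circle and changes values only
      by a positive factor.\<close>
    define s where "s = sqrt (1 + y\<^sup>2)"
    have s: "s > 0" "s\<^sup>2 = 1 + y\<^sup>2" by (auto simp: s_def add_pos_nonneg)
    have "(y / s, 1 / s) \<in> circle"
      using s(1) unfolding circle_def mem_Collect_eq prod.case power_divide add_divide_distrib[symmetric]
      by (simp add: s(2) add.commute flip: s(2))
    then have "0 \<le> bern d n (slice f (y / s) (1 / s)) j"
      using circle[of j "y / s" "1 / s"] that eval2_bpoly[of j N f] by (simp add: d_def n_def)
    moreover have "slice f y 1 = smult (s ^ degree f) (slice f (y / s) (1 / s))"
      using slice_scale[of f s "y / s" "1 / s"] s by simp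
    ultimately show ?thesis
      using s by (simp add: b bern_smult)
  qed
  have "f = (\<Sum>j\<le>n. lift2 (b j) * ((1 - var1) ^ j * var1 ^ (n - j)))"
  proof (rule eval2_eqI)
    fix x y
    have "eval2 f x y = poly (slice f y 1) x" by (simp add: poly_slice_1)
    also have "\<dots> = (\<Sum>j\<le>n. bern d n (slice f y 1) j * (1 - x) ^ j * x ^ (n - j))"
      using bern_expansion_rational[of "slice f y 1" d n "1 - x" x] degree_slice[of f y 1]
      by (simp add: d_def n_def)
    finally show "eval2 f x y = eval2 (\<Sum>j\<le>n. lift2 (b j) * ((1 - var1) ^ j * var1 ^ (n - j))) x y"
      by (simp add: b mult.assoc)
  qed
  moreover have "(\<Sum>j\<le>n. lift2 (b j) * ((1 - var1) ^ j * var1 ^ (n - j))) \<in> qmodule (n + degree f + 1)"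
  proof (rule qmodule_sum)
    fix j assume "j \<in> {..n}"
    then have j: "j \<le> n" by simp
    have "degree (b j) \<le> degree f"
      unfolding b_def by (intro degree_sum_le) (auto intro: order_trans[OF degree_monom_le])
    then have "lift2 (b j) * ((1 - var1) ^ j * var1 ^ (n - j)) \<in> qmodule (degree f + (j + (n - j) + 1))"
      using nonneg[OF j] by (intro qmodule_lift2_mult qmodule_bernstein_monomial)
    then show "lift2 (b j) * ((1 - var1) ^ j * var1 ^ (n - j)) \<in> qmodule (n + degree f + 1)"
      using j by (elim qmodule_mono) simp
  qed
  ultimately show ?thesis by (simp add: n_def)
qed

section \<open>Asymptotics of the Bernstein coefficients\<close>

text \<open>Induction on \<open>l\<close> with the absorption identity p C(p-1, q) = (p-q) C(p, q).
  For l > k both sides vanish, the product through its factor i = k.\<close>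

lemma binomial_falling_ratio:
  assumes "l \<le> n" "k \<le> n"
  shows "real ((n - l) choose (n - k)) = real (n choose k) * (\<Prod>i<l. (real k - real i) / (real n - real i))"
  using assms(1)
proof (induction l)
  case 0
  then show ?case using binomial_symmetric[OF assms(2)] by simp
next
  case (Suc l)
  define p where "p = n - l"
  have p: "p > 0" "n - Suc l = p - 1" "real n - real l = real p"
    using Suc.prems by (auto simp: p_def)
  have "real p * real ((p - 1) choose (n - k)) = (real k - real l) * real (p choose (n - k))"
  \<comment> \<open>If n - k > p both binomials are 0; otherwise the natural subtraction p - (n - k)
    is the real number k - l.\<close>
  proof (cases "n - k \<le> p")
    case True
    have "real p * real ((p - 1) choose (n - k)) = real (p - (n - k)) * real (p choose (n - k))"
      using binomial_absorb_comp[of p "n - k"] by (metis of_nat_mult)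
    also have "real (p - (n - k)) = real k - real l"
      using True assms(2) Suc.prems by (simp add: p_def of_nat_diff)
    finally show ?thesis .
  qed (simp add: binomial_eq_0)
  moreover have "real (p choose (n - k)) = real (n choose k) * (\<Prod>i<l. (real k - real i) / (real n - real i))"
    using Suc by (simp add: p_def)
  ultimately show ?case
    using p by (simp add: field_simps)
qed

section \<open>Limits along indices with k/n tending to x and polynomials tending to h\<close>

context
  fixes n k :: "nat \<Rightarrow> nat" and x :: real and g :: "nat \<Rightarrow> real poly" and h :: "real poly" and d :: nat
  assumes n_top: "filterlim n at_top sequentially"
    and ratio: "(\<lambda>r. real (k r) / real (n r)) \<longlonglongrightarrow> x"
    and kn: "\<And>r. k r \<le> n r" and dn: "\<And>r. d \<le> n r"
    and coeff_lim: "\<And>l. (\<lambda>r. coeff (g r) l) \<longlonglongrightarrow> coeff h l"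
    and deg_h: "degree h \<le> d"
begin

lemma shifted_ratio_tendsto: "(\<lambda>r. (real (k r) - c) / (real (n r) - c)) \<longlonglongrightarrow> x"
proof -
  have top: "filterlim (\<lambda>r. real (n r)) at_top sequentially"
    using n_top filterlim_real_sequentially filterlim_compose by blast
  have c: "(\<lambda>r. c / real (n r)) \<longlonglongrightarrow> 0"
    by (rule tendsto_divide_0[OF tendsto_const]) (use top filterlim_at_top_imp_at_infinity in blast)
  have "(\<lambda>r. (real (k r) / real (n r) - c / real (n r)) / (1 - c / real (n r))) \<longlonglongrightarrow> (x - 0) / (1 - 0)"
    by (intro tendsto_intros ratio c) simp
  moreover have "\<forall>\<^sub>F r in sequentially. (real (k r) / real (n r) - c / real (n r)) / (1 - c / real (n r))
      = (real (k r) - c) / (real (n r) - c)"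
    using filterlim_at_top_dense[THEN iffD1, OF top, rule_format, of "max 0 \<bar>c\<bar>"]
    proof eventually_elim
    case (elim r)
    then have "real (n r) > 0" by simp
    then have "real (k r) / real (n r) - c / real (n r) = (real (k r) - c) / real (n r)"
        "1 - c / real (n r) = (real (n r) - c) / real (n r)"
      by (simp_all add: diff_divide_distrib)
    then show ?case using \<open>real (n r) > 0\<close> by simp
  qed
  ultimately show ?thesis
    by (auto elim: Lim_transform_eventually)
qed

text \<open>The shift \<open>s\<close> is 0 for full falling products and 1 for those whose first
  factor k/n has been split off.\<close>

lemma falling_ratio_tendsto:
  "(\<lambda>r. \<Prod>i<l. (real (k r) - real (i + s)) / (real (n r) - real (i + s))) \<longlonglongrightarrow> x ^ l"
proof -
  have "(\<lambda>r. \<Prod>i<l. (real (k r) - real (i + s)) / (real (n r) - real (i + s))) \<longlonglongrightarrow> (\<Prod>i<l. x)"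
    by (intro tendsto_prod shifted_ratio_tendsto)
  then show ?thesis by simp
qed

text \<open>The binomial in front is positive, so the sign is that of the remaining sum, whose limit
  can be computed.\<close>

lemma bern_falling_ratio:
  "bern d (n r) (g r) (n r - k r) = real (n r choose k r) *
     (\<Sum>l\<le>d. coeff (g r) l * (\<Prod>i<l. (real (k r) - real i) / (real (n r) - real i)))"
  unfolding bern_def sum_distrib_left
proof (intro sum.cong refl)
  fix l assume "l \<in> {..d}"
  then have "l \<le> n r" using dn[of r] by simp
  from binomial_falling_ratio[OF this kn]
  show "coeff (g r) l * real (n r - l choose (n r - k r)) = real (n r choose k r) *
      (coeff (g r) l * (\<Prod>i<l. (real (k r) - real i) / (real (n r) - real i)))"
    by simp
qed

text \<open>The falling products tend to x^l, so the sum tends to h(x). This covers end points of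
  [0,1] where \<open>h\<close> is positive as well.\<close>

lemma bern_eventually_nonneg_interior:
  assumes "poly h x > 0"
  shows "\<forall>\<^sub>F r in sequentially. bern d (n r) (g r) (n r - k r) \<ge> 0"
proof -
  have "poly h x = (\<Sum>l\<le>d. coeff h l * x ^ l)"
    unfolding poly_altdef using deg_h by (intro sum.mono_neutral_left) (auto simp: coeff_eq_0)
  moreover have "(\<lambda>r. \<Sum>l\<le>d. coeff (g r) l * (\<Prod>i<l. (real (k r) - real i) / (real (n r) - real i)))
      \<longlonglongrightarrow> (\<Sum>l\<le>d. coeff h l * x ^ l)"
    by (intro tendsto_intros coeff_lim falling_ratio_tendsto[where s = 0, unfolded add_0_right])
  ultimately have "\<forall>\<^sub>F r in sequentially.
      (\<Sum>l\<le>d. coeff (g r) l * (\<Prod>i<l. (real (k r) - real i) / (real (n r) - real i))) > 0"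
    using assms by (auto dest: order_tendstoD)
  then show ?thesis
    by eventually_elim (simp add: bern_falling_ratio)
qed

text \<open>At the end point \<open>0\<close> the factor \<open>k / n\<close> splits off from all summands except the constant
  one, and what remains converges to the derivative of \<open>h\<close> at \<open>0\<close>.\<close>

lemma bern_eventually_nonneg_endpoint:
  assumes x: "x = 0" and const: "\<And>r. coeff (g r) 0 \<ge> 0" and lin: "coeff h 1 > 0"
  shows "\<forall>\<^sub>F r in sequentially. bern d (n r) (g r) (n r - k r) \<ge> 0"
proof -
  \<comment> \<open>The falling product of length l + 1 without its first factor k/n, hence the
    indices shifted by one.\<close>
  define q where "q r l = (\<Prod>i<l. (real (k r) - real (i + 1)) / (real (n r) - real (i + 1)))" for r l
  have "d \<ge> 1"
    using lin deg_h by (metis One_nat_def coeff_eq_0 less_one not_le order.strict_trans2 less_irrefl)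
  \<comment> \<open>With x = 0 only the term l = 0 remains, as \<open>0 ^ 0\<close> is 1.\<close>
  then have "(\<Sum>l<d. coeff h (Suc l) * x ^ l) = coeff h 1"
    by (cases d) (simp_all add: x sum.lessThan_Suc_shift del: sum.lessThan_Suc)
  moreover have "(\<lambda>r. \<Sum>l<d. coeff (g r) (Suc l) * q r l) \<longlonglongrightarrow> (\<Sum>l<d. coeff h (Suc l) * x ^ l)"
    unfolding q_def by (intro tendsto_intros coeff_lim falling_ratio_tendsto)
  ultimately have "\<forall>\<^sub>F r in sequentially. (\<Sum>l<d. coeff (g r) (Suc l) * q r l) > 0"
    using lin by (auto dest: order_tendstoD)
  then show ?thesis
  proof eventually_elim
    case (elim r)
    have "(\<Prod>i<Suc l. (real (k r) - real i) / (real (n r) - real i)) = real (k r) / real (n r) * q r l" for l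
      by (simp add: q_def prod.lessThan_Suc_shift del: prod.lessThan_Suc)
    then have "(\<Sum>l\<le>d. coeff (g r) l * (\<Prod>i<l. (real (k r) - real i) / (real (n r) - real i)))
        = coeff (g r) 0 + real (k r) / real (n r) * (\<Sum>l<d. coeff (g r) (Suc l) * q r l)"
      by (simp add: sum.atMost_shift sum_distrib_left mult_ac del: prod.lessThan_Suc)
    then show ?case
      using elim const[of r] by (simp add: bern_falling_ratio)
  qed
qed

end

text \<open>Reflection x -> 1 - x reduces this to the end point 0: it sends the index j to n - j and
  flips the sign of the derivative.\<close>

lemma bern_eventually_nonneg_right_endpoint:
  assumes n_top: "filterlim n at_top sequentially"
    and ratio: "(\<lambda>r. real (k r) / real (n r)) \<longlonglongrightarrow> 1"
    and kn: "\<And>r. k r \<le> n r" and dn: "\<And>r. d \<le> n r"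
    and coeff_lim: "\<And>l. (\<lambda>r. coeff (g r) l) \<longlonglongrightarrow> coeff h l"
    and deg_h: "degree h \<le> d" and deg_g: "\<And>r. degree (g r) \<le> d"
    and const: "\<And>r. poly (g r) 1 \<ge> 0" and lin: "poly (pderiv h) 1 < 0"
  shows "\<forall>\<^sub>F r in sequentially. bern d (n r) (g r) (n r - k r) \<ge> 0"
proof -
  let ?R = "\<lambda>p :: real poly. pcompose p [:1, -1:]"
  \<comment> \<open>The reflected coefficients are fixed finite linear combinations of the original
    ones, so coefficientwise convergence is preserved.\<close>
  have coeff_R: "coeff (?R p) l = (\<Sum>i\<le>d. coeff p i * coeff ([:1, -1:] ^ i) l)" if "degree p \<le> d" for p l
  proof -
    have "?R p = (\<Sum>i\<le>d. smult (coeff p i) ([:1, -1:] ^ i))"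
      unfolding pcompose_altdef poly_altdef using that
      by (subst coeff_map_poly) (auto intro!: sum.mono_neutral_cong_left simp: coeff_map_poly coeff_eq_0
          intro: le_degree order_trans[OF map_poly_degree_leq])
    then show ?thesis by (simp add: coeff_sum)
  qed
  have "\<forall>\<^sub>F r in sequentially. bern d (n r) (?R (g r)) (n r - (n r - k r)) \<ge> 0"
  proof (rule bern_eventually_nonneg_endpoint[where x = 0 and h = "?R h"])
    \<comment> \<open>For n = 0 the next identity would read 1 = 0, as division by zero gives
      0.\<close>
    have "\<forall>\<^sub>F r in sequentially. n r > 0"
      by (rule eventually_compose_filterlim[OF eventually_gt_at_top n_top])
    then have "\<forall>\<^sub>F r in sequentially. 1 - real (k r) / real (n r) = real (n r - k r) / real (n r)"
      by eventually_elim (simp add: of_nat_diff[OF kn] diff_divide_distrib)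
    moreover have "(\<lambda>r. 1 - real (k r) / real (n r)) \<longlonglongrightarrow> 1 - 1"
      by (intro tendsto_intros ratio)
    ultimately show "(\<lambda>r. real (n r - k r) / real (n r)) \<longlonglongrightarrow> 0"
      by (auto elim: Lim_transform_eventually)
    show "(\<lambda>r. coeff (?R (g r)) l) \<longlonglongrightarrow> coeff (?R h) l" for l
      unfolding coeff_R[OF deg_h] coeff_R[OF deg_g] by (intro tendsto_intros coeff_lim)
    show "degree (?R h) \<le> d" using deg_h by (simp add: degree_pcompose)
    show "coeff (?R (g r)) 0 \<ge> 0" for r
      using const[of r] by (simp add: poly_0_coeff_0[symmetric] poly_pcompose)
    have "coeff (?R h) 1 = poly (pderiv (?R h)) 0"
      by (simp add: poly_0_coeff_0 coeff_pderiv)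
    also have "\<dots> = - poly (pderiv h) 1"
      by (simp add: pderiv_pcompose poly_pcompose pderiv_pCons)
    finally show "coeff (?R h) 1 > 0" using lin by simp
  qed (use n_top dn in auto)
  then show ?thesis
    using bern_reflect[OF deg_g dn] kn by (simp add: bern_reflect[OF deg_g dn])
qed

section \<open>Nonnegativity on the circle\<close>

text \<open>A negative derivative would make \<open>p\<close> negative immediately to the right of
  0.\<close>

lemma poly_nonneg_left_zero_deriv:
  fixes p :: "real poly"
  assumes "\<And>x. x \<in> {0..1} \<Longrightarrow> poly p x \<ge> 0" "poly p 0 = 0"
  shows "poly (pderiv p) 0 \<ge> 0"
proof (rule ccontr)
  assume "\<not> ?thesis"
  then obtain e where e: "e > 0" "\<And>h. 0 < h \<Longrightarrow> h < e \<Longrightarrow> poly p (0 + h) < poly p 0"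
    using DERIV_neg_dec_right[OF poly_DERIV, of p 0] by fastforce
  define h where "h = min 1 (e / 2)"
  have "0 < h" "h < e" "h \<le> 1" using e(1) by (auto simp: h_def)
  then show False using e(2)[of h] assms(1)[of h] assms(2) by simp
qed

lemma poly_nonneg_right_zero_deriv:
  fixes p :: "real poly"
  assumes "\<And>x. x \<in> {0..1} \<Longrightarrow> poly p x \<ge> 0" "poly p 1 = 0"
  shows "poly (pderiv p) 1 \<le> 0"
proof -
  have "poly (pderiv (pcompose p [:1, -1:])) 0 \<ge> 0"
    using assms by (intro poly_nonneg_left_zero_deriv) (auto simp: poly_pcompose)
  then show ?thesis
    by (simp add: pderiv_pcompose poly_pcompose pderiv_pCons)
qed

text \<open>Differentiation in X commutes with fixing Y; this turns the hypothesis on the partial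
  derivative into one on slices.\<close>

lemma eval2_pderiv1: "eval2 (pderiv1 f) x y = poly (pderiv (slice f y 1)) x"
proof -
  have "degree (pderiv1 f) \<le> degree f"
    by (simp add: pderiv1_def map_poly_degree_leq)
  then have "eval2 (pderiv1 f) x y = (\<Sum>i\<le>degree f. poly (coeff (pderiv1 f) i) x * y ^ i)"
    unfolding eval2_altdef by (intro sum.mono_neutral_left) (auto simp: coeff_eq_0)
  also have "\<dots> = (\<Sum>i\<le>degree f. poly (pderiv (coeff f i)) x * y ^ i)"
    by (simp add: pderiv1_def coeff_map_poly)
  also have "\<dots> = poly (pderiv (slice f y 1)) x"
    by (simp add: slice_def poly_sum pderiv_smult higher_pderiv_sum[where n = 1, simplified] mult.commute)
  finally show ?thesis .
qed

text \<open>Counterexamples for all N would have a convergent subsequence of points and slices, and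
  each possible limit is excluded by one of the three eventual nonnegativity results.\<close>

lemma bpoly_nonneg_exists:
  fixes f :: "real poly poly"
  assumes nonneg: "\<And>x y. x \<in> {0..1} \<Longrightarrow> eval2 f x y \<ge> 0"
    and fully: "fully_ic (degree f) f"
    and zeros: "strip_zeros f \<subseteq> {0, 1} \<times> UNIV"
    and deriv: "\<And>x y. (x, y) \<in> strip_zeros f \<Longrightarrow> eval2 (pderiv1 f) x y \<noteq> 0"
  shows "\<exists>N. \<forall>j\<le>N + deg1 f. \<forall>(y, z)\<in>circle. eval2 (bpoly f N j) y z \<ge> 0"
proof (rule ccontr)
  assume "\<not> ?thesis"
  then have "\<forall>N. \<exists>j y z. j \<le> N + deg1 f \<and> (y, z) \<in> circle \<and> eval2 (bpoly f N j) y z < 0"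
    by (metis (mono_tags, lifting) case_prodI2 not_le_imp_less)
  then obtain j y z where jyz: "\<And>N. j N \<le> N + deg1 f" "\<And>N. (y N, z N) \<in> circle"
    and neg: "\<And>N. eval2 (bpoly f N (j N)) (y N) (z N) < (0::real)"
    by metis
  define d where "d = deg1 f"
  \<comment> \<open>The first component is k/n with n = N + d and k = n - j, the position in [0,1]
    belonging to the index j.\<close>
  define v where "v N = (real (N + d - j N) / real (N + d), y N, z N)" for N
  have range: "v N \<in> {0..1} \<times> {-1..1} \<times> {-1..1}" for N
  proof -
    have "(y N)\<^sup>2 + (z N)\<^sup>2 = 1" using jyz(2)[of N] by (simp add: circle_def)
    then have "(y N)\<^sup>2 \<le> 1" "(z N)\<^sup>2 \<le> 1"
      by (metis le_add_same_cancel1 le_add_same_cancel2 zero_le_power2)+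
    then show ?thesis
      by (auto simp: v_def abs_square_le_1 abs_le_iff divide_le_eq_1)
  qed
  have "compact ({0..1} \<times> {-1..1} \<times> {-1..1} :: (real \<times> real \<times> real) set)"
    by (intro compact_Times compact_Icc)
  then obtain l \<rho> where l: "l \<in> {0..1} \<times> {-1..1} \<times> {-1..1}" and mono: "strict_mono \<rho>"
    and lim: "(v \<circ> \<rho>) \<longlonglongrightarrow> l"
    using range unfolding compact_def by metis
  obtain x Y Z where xyz: "l = (x, Y, Z)" by (cases l)
  have x: "x \<in> {0..1}" using l xyz by simp
  define n where "n r = \<rho> r + d" for r
  define k where "k r = n r - j (\<rho> r)" for r
  define g where "g r = slice f (y (\<rho> r)) (z (\<rho> r))" for r
  define h where "h = slice f Y Z"
  have lims: "(\<lambda>r. real (k r) / real (n r)) \<longlonglongrightarrow> x" "(\<lambda>r. y (\<rho> r)) \<longlonglongrightarrow> Y" "(\<lambda>r. z (\<rho> r)) \<longlonglongrightarrow> Z"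
    using tendsto_fst[OF lim] tendsto_fst[OF tendsto_snd[OF lim]] tendsto_snd[OF tendsto_snd[OF lim]]
    by (simp_all add: xyz v_def o_def k_def n_def)
  have "(\<lambda>r. (y (\<rho> r))\<^sup>2 + (z (\<rho> r))\<^sup>2) \<longlonglongrightarrow> Y\<^sup>2 + Z\<^sup>2"
    by (intro tendsto_intros lims)
  then have YZ: "Y\<^sup>2 + Z\<^sup>2 = 1"
    using jyz(2) by (simp add: circle_def LIMSEQ_const_iff)
  have n_top: "filterlim n at_top sequentially"
    unfolding n_def using filterlim_subseq[OF mono]
    by (rule filterlim_at_top_mono) simp
  have kn: "k r \<le> n r" and dn: "d \<le> n r" and nk: "n r - k r = j (\<rho> r)" for r
    using jyz(1)[of "\<rho> r"] by (simp_all add: k_def n_def d_def)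
  have coeff_lim: "(\<lambda>r. coeff (g r) l) \<longlonglongrightarrow> coeff h l" for l
    unfolding g_def h_def coeff_slice by (intro tendsto_intros lims)
  have deg: "degree h \<le> d" "degree (g r) \<le> d" for r
    using degree_slice by (simp_all add: g_def h_def d_def)
  have not_ev: "\<not> (\<forall>\<^sub>F r in sequentially. bern d (n r) (g r) (n r - k r) \<ge> 0)"
  proof -
    have "bern d (n r) (g r) (n r - k r) < 0" for r
      using neg[of "\<rho> r"] eval2_bpoly[OF jyz(1)] unfolding nk by (simp add: g_def n_def d_def)
    then show ?thesis by (auto simp: not_le eventually_sequentially)
  qed

  \<comment> \<open>Being fully m-ic means that f(t, Y) keeps degree m, so its leading coefficient
    is that of \<open>f\<close> at t. Nonnegativity makes it positive and m even.\<close>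
  have lead: "poly (lead_coeff f) t > 0" and even: "even (degree f)" if t: "t \<in> {0..1}" for t
  proof -
    have fic: "subst1 f t \<noteq> 0" "degree (subst1 f t) = degree f"
      using fully t by (auto simp: fully_ic_def)
    have "poly (subst1 f t) s \<ge> 0" for s
      using nonneg[OF t] by (simp add: eval2_def)
    from nonneg_poly_lead_coeff[OF this fic(1)] nonneg_poly_even_degree[OF this]
    show "poly (lead_coeff f) t > 0" "even (degree f)"
      unfolding fic(2) by (simp_all add: subst1_def coeff_map_poly)
  qed
  have even: "even (degree f)" using even[of 0] by simp
  \<comment> \<open>As m is even, the factors b^m and, at b = 0, a^m are nonnegative.\<close>
  have slice_nonneg: "poly (slice f a b) t \<ge> 0" if t: "t \<in> {0..1}" for a b t
  proof (cases "b = 0")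
    case True
    then show ?thesis using lead[OF t] even by (simp add: slice_0 zero_le_even_power less_imp_le)
  next
    case False
    then show ?thesis using nonneg[OF t] even
      by (simp add: slice_nonzero[OF False] poly_slice_1 zero_le_even_power)
  qed
  \<comment> \<open>A positive limit value would make the coefficients eventually nonnegative, so
    the limit point is a zero of the limit slice.\<close>
  have "\<not> poly h x > 0"
    using bern_eventually_nonneg_interior[OF n_top lims(1) kn dn coeff_lim deg(1)] not_ev by blast
  then have hx: "poly h x = 0"
    using slice_nonneg[OF x, of Y Z] by (simp add: h_def)
  \<comment> \<open>The zero is not at infinity: there the slice is Y^m times the positive leading
    coefficient.\<close>
  have Z: "Z \<noteq> 0"
  proof
    assume "Z = 0"
    then have "poly h x = Y ^ degree f * poly (lead_coeff f) x" "Y \<noteq> 0"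
      using YZ by (auto simp: h_def slice_0)
    then show False using lead[OF x] hx by simp
  qed
  have h: "h = smult (Z ^ degree f) (slice f (Y / Z) 1)"
    unfolding h_def by (rule slice_nonzero[OF Z])
  have zero: "(x, Y / Z) \<in> strip_zeros f"
    using hx Z x by (simp add: h strip_zeros_def poly_slice_1)
  \<comment> \<open>\<open>h\<close> is a nonzero multiple of the slice at (Y/Z, 1), so its
    derivative is a nonzero multiple of the partial derivative of \<open>f\<close>.\<close>
  have dh: "poly (pderiv h) x \<noteq> 0"
    using deriv[OF zero] Z by (simp add: h pderiv_smult eval2_pderiv1)
  have "x = 0 \<or> x = 1" using zeros zero by auto
  then show False
  proof
    assume x: "x = 0"
    \<comment> \<open>Nonnegativity on [0,1] and the zero at the end point fix the sign of this
      nonzero derivative.\<close>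
    then have "poly (pderiv h) 0 > 0"
      using poly_nonneg_left_zero_deriv[of h] slice_nonneg hx dh by (force simp: h_def)
    then have "coeff h 1 > 0" by (simp add: poly_0_coeff_0 coeff_pderiv)
    moreover have "coeff (g r) 0 \<ge> 0" for r
      using slice_nonneg[of 0] by (simp add: g_def poly_0_coeff_0)
    ultimately show False
      using bern_eventually_nonneg_endpoint[OF n_top lims(1) kn dn coeff_lim deg(1) x] not_ev by blast
  next
    assume x: "x = 1"
    then have "poly (pderiv h) 1 < 0"
      using poly_nonneg_right_zero_deriv[of h] slice_nonneg hx dh by (force simp: h_def)
    moreover have "poly (g r) 1 \<ge> 0" for r
      using slice_nonneg[of 1] by (simp add: g_def)
    ultimately show False
      using bern_eventually_nonneg_right_endpoint[OF n_top lims(1)[unfolded x] kn dn coeff_lim deg] not_ev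
      by blast
  qed
qed

theorem theorem19:
  fixes f :: "real poly poly" and m d :: nat
  assumes nonneg: "\<And>x y. x \<in> {0..1} \<Longrightarrow> eval2 f x y \<ge> 0"
    and m: "m = deg2 f"
    and d: "d = deg1 f"
    and fully: "fully_ic m f"
    and finite_zeros: "finite (strip_zeros f)"
    and zeros: "strip_zeros f \<subseteq> {0, 1} \<times> UNIV"
    and deriv: "\<And>x y. (x, y) \<in> strip_zeros f \<Longrightarrow> eval2 (pderiv1 f) x y \<noteq> 0"
  shows "(\<exists>N. \<forall>j\<le>N + d. \<forall>(y, z)\<in>circle. eval2 (bpoly f N j) y z \<ge> 0) \<and>
    (\<forall>N. (\<forall>j\<le>N + d. \<forall>(y, z)\<in>circle. eval2 (bpoly f N j) y z \<ge> 0) \<longrightarrow>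
      (\<exists>\<sigma>0\<in>sums_of_squares. \<exists>\<sigma>1\<in>sums_of_squares.
        f = \<sigma>0 + \<sigma>1 * var1 * (1 - var1) \<and>
        total_deg \<sigma>0 \<le> N + d + m + 1 \<and>
        total_deg (\<sigma>1 * var1 * (1 - var1)) \<le> N + d + m + 1))"
proof (intro conjI allI impI)
  show "\<exists>N. \<forall>j\<le>N + d. \<forall>(y, z)\<in>circle. eval2 (bpoly f N j) y z \<ge> 0"
    unfolding d using nonneg fully[unfolded m] zeros deriv by (rule bpoly_nonneg_exists)
next
  fix N assume "\<forall>j\<le>N + d. \<forall>(y, z)\<in>circle. eval2 (bpoly f N j) y z \<ge> 0"
  then have "f \<in> qmodule (N + d + m + 1)"
    unfolding d m by (intro certificate) auto
  then show "\<exists>\<sigma>0\<in>sums_of_squares. \<exists>\<sigma>1\<in>sums_of_squares.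
      f = \<sigma>0 + \<sigma>1 * var1 * (1 - var1) \<and>
      total_deg \<sigma>0 \<le> N + d + m + 1 \<and>
      total_deg (\<sigma>1 * var1 * (1 - var1)) \<le> N + d + m + 1"
    by (simp only: qmodule_def mem_Collect_eq)
qed

end
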